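(* Let $X$ be a unital Banach algebra over $K$ ($K=\mathbb{R}$ or $\mathbb{C}$), with a quasi-product $[\cdot,\cdot]_X$ and maps $g,\gamma:X\to X$ as fixed in the context. Let $F\in B(X)$ be generalized real definite with $F(0)=0$. Suppose that the uniform spectral representation condition holds, i.e. the quasi-product either (a) is square bounded below and preserves the positivity, or (b) has a left integral domain. Then there is a bounded interval $[m,M]\subset\mathbb{R}$ depending on $F$ such that $F$ has the spectral representation $$F=\int_m^M\lambda\,d(\gamma\circ E_\lambda).$$
   Context: Spaces are nontrivial. $B(X)$ is the set of all (possibly nonlinear) maps $F:X\to X$ with $\|F\|_{B(X)}:=\max\left(\sup_{x\ne0}\|F(x)\|_X/\|x\|_X,\ \|F(0)\|_X\right)<\infty$; it is a normed space under pointwise operations. A quasi-product on $X$ is a map $[\cdot,\cdot]_X:X\times X\to K$ such that: (a) $[x,x]_X\ge0$ for all $x$; (b) there is $\overline c>0$ with $|[x,y]_X|\le\overline c\|x\|_X\|y\|_X$ for all $x,y$; (c) there is a positive function $c:X\to\mathbb{R}$, bounded and bounded away from $0$, with $[\sum_{i=1}^n\alpha_ix_i,y]_X=c(y)\sum_{i=1}^n\alpha_i[x_i,y]_X$ for all $n\ge1$, $x_i,y\in X$, $\alpha_i\in K$. Fix a quasi-product $[\cdot,\cdot]_X$ and a map $g:X\to X$ with $g(x)\neq0$ for $x\ne0$. A map $F:X\to X$ is generalized real definite if $[F(x),g(x)]_X\in\mathbb{R}$ for all $x\in X$, and g-positive if $[F(x),g(x)]_X\ge0$ for all $x\in X$.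 Fix also a g-positive map $\gamma:X\to X$ with $[\gamma(x),g(x)]_X=k_1(x)\|x\|_X\|g(x)\|_X$ and $\|\gamma(x)\|_X=k_2(x)\|x\|_X$ for all $x$, where $k_1,k_2$ are positive bounded functions bounded away from $0$. The quasi-product: has a left integral domain if for $x,y\in X$ with $g(x)\ne0$, $[y,g(x)]_X=0$ implies $y=0$; preserves the positivity if for $x,y_1,y_2\in X$, $[y_1,g(x)]_X\ge0$ and $[y_2,g(x)]_X\ge0$ imply $[y_1y_2,g(x)]_X\ge0$; is square bounded below if there is $\underline k>0$ such that for $x,y\in X$, $[y^2,g(x)]_X\ge\underline k\|y\|_X^2\|g(x)\|_X$ whenever $y=1$ or $[y,g(x)]_X\in\mathbb{R}$. For generalized real definite $F$, $|F|(x)=F(x)$ if $[F(x),g(x)]_X\ge0$ and $|F|(x)=-F(x)$ otherwise; $F^+=(|F|+F)/2$. For $\lambda\in\mathbb{R}$, $F_\lambda=F-\lambda\gamma$, and $E_\lambda:X\to X$ is given by $E_\lambda(x)=x$ if $F_\lambda^+(x)=0$ and $E_\lambda(x)=0$ otherwise. For partitions $m=s_0<s_1<\dots<s_n=M$ with $s_j-s_{j-1}<\epsilon_n$, $0<\epsilon_n\to0$, and $\lambda_j\in(s_{j-1},s_j]$, put $E_{\Delta_j}=E_{s_j}-E_{s_{j-1}}$. The operator $\int_m^M\lambda\,d(\gamma\circ E_\lambda)$ denotes the limit in $\|\cdot\|_{B(X)}$, as $n\to\infty$, of $\sum_{j=1}^n\lambda_j(\gamma\circ E_{\Delta_j})$,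 when it exists independently of the choice of the $\lambda_j$. *)

theory Defs
  imports "HOL-Analysis.Analysis"
begin

(* The scalar field K = R or C. The norm of a real_normed_field is multiplicative and extends
   the absolute value of the reals, so in the second case it is the usual modulus. *)
class real_or_complex = real_normed_field +
  assumes real_or_complex:
    "(\<forall>z. \<exists>a. z = a *\<^sub>R 1) \<or>
     (\<exists>i. i * i = - 1 \<and> (\<forall>z. \<exists>a b. z = a *\<^sub>R 1 + b *\<^sub>R i))"

instance real :: real_or_complex
  by standard simp

instance complex :: real_or_complex
proof
  have "\<exists>a b. z = a *\<^sub>R 1 + b *\<^sub>R \<i>" for z :: complex
    by (intro exI[of _ "Re z"] exI[of _ "Im z"]) (simp add: complex_eq_iff)
  moreover have "\<i> * \<i> = (- 1 :: complex)"
    by simp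
  ultimately show "(\<forall>z::complex. \<exists>a. z = a *\<^sub>R 1) \<or>
      (\<exists>i::complex. i * i = - 1 \<and> (\<forall>z. \<exists>a b. z = a *\<^sub>R 1 + b *\<^sub>R i))"
    by blast
qed

(* Unital Banach algebras over K. The type classes provide the norm, completeness, the product
   and 0 \<noteq> 1; the locale adds the K-linear structure. For K = R the only instance is scaleR. *)
locale unital_banach_algebra_over = vector_space smul
  for smul :: "'k::real_or_complex \<Rightarrow> 'a::{real_normed_algebra_1, banach} \<Rightarrow> 'a" +
  assumes smul_of_real: "smul (of_real r) x = r *\<^sub>R x"
    and norm_smul: "norm (smul a x) = norm a * norm x"
    and smul_mult_left: "smul a x * y = smul a (x * y)"
    and smul_mult_right: "x * smul a y = smul a (x * y)"

lemma unital_banach_algebra_over_real: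
  "unital_banach_algebra_over
    (scaleR :: real \<Rightarrow> 'a::{real_normed_algebra_1, banach} \<Rightarrow> 'a)"
  by unfold_locales (auto simp: algebra_simps)

lemma unital_banach_algebra_over_complex:
  "unital_banach_algebra_over ((*) :: complex \<Rightarrow> complex \<Rightarrow> complex)"
  by unfold_locales (auto simp: algebra_simps scaleR_conv_of_real norm_mult)

(* z \<ge> b for a scalar z and a real number b includes the assertion that z is real. *)
definition scalar_ge :: "'k::real_or_complex \<Rightarrow> real \<Rightarrow> bool" where
  "scalar_ge z b \<longleftrightarrow> (\<exists>r. z = of_real r \<and> b \<le> r)"

definition positive_bounded_away :: "('a \<Rightarrow> real) \<Rightarrow> bool" where
  "positive_bounded_away c \<longleftrightarrow> (\<exists>a b. 0 < a \<and> (\<forall>x. a \<le> c x \<and> c x \<le> b))"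

definition B_norm :: "('a::real_normed_vector \<Rightarrow> 'a) \<Rightarrow> ereal" where
  "B_norm F = max (SUP x\<in>{x. x \<noteq> 0}. ereal (norm (F x) / norm x)) (ereal (norm (F 0)))"

definition B_space :: "('a::real_normed_vector \<Rightarrow> 'a) set" where
  "B_space = {F. B_norm F < \<infinity>}"

definition quasi_product ::
  "('k::real_or_complex \<Rightarrow> 'a::real_normed_vector \<Rightarrow> 'a) \<Rightarrow> ('a \<Rightarrow> 'a \<Rightarrow> 'k) \<Rightarrow> bool" where
  "quasi_product smul q \<longleftrightarrow>
     (\<forall>x. scalar_ge (q x x) 0) \<and>
     (\<exists>C>0. \<forall>x y. norm (q x y) \<le> C * norm x * norm y) \<and>
     (\<exists>c. positive_bounded_away c \<and>
       (\<forall>n\<ge>1. \<forall>(\<alpha>::nat \<Rightarrow> 'k) (x::nat \<Rightarrow> 'a) y.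
          q (\<Sum>i=1..n. smul (\<alpha> i) (x i)) y = of_real (c y) * (\<Sum>i=1..n. \<alpha> i * q (x i) y)))"

definition generalized_real_definite ::
  "('a \<Rightarrow> 'a \<Rightarrow> 'k::real_or_complex) \<Rightarrow> ('a \<Rightarrow> 'a) \<Rightarrow> ('a \<Rightarrow> 'a) \<Rightarrow> bool" where
  "generalized_real_definite q g F \<longleftrightarrow> (\<forall>x. q (F x) (g x) \<in> \<real>)"

definition g_positive ::
  "('a \<Rightarrow> 'a \<Rightarrow> 'k::real_or_complex) \<Rightarrow> ('a \<Rightarrow> 'a) \<Rightarrow> ('a \<Rightarrow> 'a) \<Rightarrow> bool" where
  "g_positive q g F \<longleftrightarrow> (\<forall>x. scalar_ge (q (F x) (g x)) 0)"

definition left_integral_domain ::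
  "('a::real_normed_vector \<Rightarrow> 'a \<Rightarrow> 'k::real_or_complex) \<Rightarrow> ('a \<Rightarrow> 'a) \<Rightarrow> bool" where
  "left_integral_domain q g \<longleftrightarrow> (\<forall>x y. g x \<noteq> 0 \<longrightarrow> q y (g x) = 0 \<longrightarrow> y = 0)"

definition preserves_positivity ::
  "('a::real_normed_algebra_1 \<Rightarrow> 'a \<Rightarrow> 'k::real_or_complex) \<Rightarrow> ('a \<Rightarrow> 'a) \<Rightarrow> bool" where
  "preserves_positivity q g \<longleftrightarrow>
     (\<forall>x y1 y2. scalar_ge (q y1 (g x)) 0 \<longrightarrow> scalar_ge (q y2 (g x)) 0 \<longrightarrow>
        scalar_ge (q (y1 * y2) (g x)) 0)"

definition square_bounded_below ::
  "('a::real_normed_algebra_1 \<Rightarrow> 'a \<Rightarrow> 'k::real_or_complex) \<Rightarrow> ('a \<Rightarrow> 'a) \<Rightarrow> bool" where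
  "square_bounded_below q g \<longleftrightarrow>
     (\<exists>k>0. \<forall>x y. y = 1 \<or> q y (g x) \<in> \<real> \<longrightarrow>
        scalar_ge (q (y\<^sup>2) (g x)) (k * (norm y)\<^sup>2 * norm (g x)))"

definition uniform_spectral_representation_condition ::
  "('a::real_normed_algebra_1 \<Rightarrow> 'a \<Rightarrow> 'k::real_or_complex) \<Rightarrow> ('a \<Rightarrow> 'a) \<Rightarrow> bool" where
  "uniform_spectral_representation_condition q g \<longleftrightarrow>
     square_bounded_below q g \<and> preserves_positivity q g \<or> left_integral_domain q g"

definition abs_map ::
  "('a::real_normed_vector \<Rightarrow> 'a \<Rightarrow> 'k::real_or_complex) \<Rightarrow> ('a \<Rightarrow> 'a) \<Rightarrow> ('a \<Rightarrow> 'a) \<Rightarrow> 'a \<Rightarrow> 'a"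
  where "abs_map q g F x = (if scalar_ge (q (F x) (g x)) 0 then F x else - F x)"

definition pos_part_map ::
  "('a::real_normed_vector \<Rightarrow> 'a \<Rightarrow> 'k::real_or_complex) \<Rightarrow> ('a \<Rightarrow> 'a) \<Rightarrow> ('a \<Rightarrow> 'a) \<Rightarrow> 'a \<Rightarrow> 'a"
  where "pos_part_map q g F x = (abs_map q g F x + F x) /\<^sub>R 2"

definition spectral_family ::
  "('a::real_normed_vector \<Rightarrow> 'a \<Rightarrow> 'k::real_or_complex) \<Rightarrow> ('a \<Rightarrow> 'a) \<Rightarrow> ('a \<Rightarrow> 'a) \<Rightarrow>
   ('a \<Rightarrow> 'a) \<Rightarrow> real \<Rightarrow> 'a \<Rightarrow> 'a" where
  "spectral_family q g \<gamma> F l x =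
     (if pos_part_map q g (\<lambda>z. F z - l *\<^sub>R \<gamma> z) x = 0 then x else 0)"

(* The n-th member (n \<ge> 1) of the sequence of partitions is m = s n 0 < \<dots> < s n n = M,
   with tags t n 1, \<dots>, t n n. *)
definition tagged_partition_sequence ::
  "real \<Rightarrow> real \<Rightarrow> (nat \<Rightarrow> nat \<Rightarrow> real) \<Rightarrow> (nat \<Rightarrow> nat \<Rightarrow> real) \<Rightarrow> bool" where
  "tagged_partition_sequence m M s t \<longleftrightarrow>
     (\<exists>\<epsilon>. (\<forall>n. 0 < \<epsilon> n) \<and> \<epsilon> \<longlonglongrightarrow> 0 \<and>
       (\<forall>n\<ge>1. s n 0 = m \<and> s n n = M \<and>
          (\<forall>j\<in>{1..n}. s n (j - 1) < s n j \<and> s n j - s n (j - 1) < \<epsilon> n \<and>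
             t n j \<in> {s n (j - 1)<..s n j})))"

definition spectral_sum ::
  "('a::real_normed_vector \<Rightarrow> 'a) \<Rightarrow> (real \<Rightarrow> 'a \<Rightarrow> 'a) \<Rightarrow> (nat \<Rightarrow> real) \<Rightarrow> (nat \<Rightarrow> real) \<Rightarrow>
   nat \<Rightarrow> 'a \<Rightarrow> 'a" where
  "spectral_sum \<gamma> E s t n x = (\<Sum>j=1..n. t j *\<^sub>R \<gamma> (E (s j) x - E (s (j - 1)) x))"

(* T is the integral of \<lambda> d(\<gamma> \<circ> E) over [m, M]. The requirement m < M excludes the degenerate
   interval, which has no partitions and for which the condition on T would be vacuous. *)
definition has_spectral_integral ::
  "('a::real_normed_vector \<Rightarrow> 'a) \<Rightarrow> (real \<Rightarrow> 'a \<Rightarrow> 'a) \<Rightarrow> ('a \<Rightarrow> 'a) \<Rightarrow> real \<Rightarrow> real \<Rightarrow> bool"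
  where
  "has_spectral_integral \<gamma> E T m M \<longleftrightarrow>
     m < M \<and> T \<in> B_space \<and>
     (\<forall>s t. tagged_partition_sequence m M s t \<longrightarrow>
        (\<lambda>n. B_norm (\<lambda>x. spectral_sum \<gamma> E (s n) (t n) n x - T x)) \<longlonglongrightarrow> 0)"

end

theory Submission
  imports Defs
begin

text \<open>
  Under either alternative of the spectral representation condition, \<open>[y, g x] = 0\<close> forces
  \<open>y = 0\<close>: if \<open>[y, g x] = 0\<close>, then \<open>y\<close> and \<open>- y\<close> are both nonnegative against \<open>g x\<close>, so preservation
  of positivity makes \<open>[- y\<^sup>2, g x] \<ge> 0\<close>, against the lower bound on squares. The quasi-product is
  linear in its first argument, so with \<open>r = [F x, g x] / [\<gamma> x, g x]\<close> the vector
  \<open>F x - r \<gamma> x\<close> vanishes: \<open>F\<close> is pointwise a real multiple \<open>r x\<close> of \<open>\<gamma>\<close>. Thus \<open>E\<^sub>\<lambda> x\<close> is \<open>x\<close> for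
  \<open>\<lambda> \<ge> r x\<close> and \<open>0\<close> for \<open>\<lambda> < r x\<close>, every spectral sum at \<open>x\<close> collapses to \<open>\<lambda>\<^sub>j \<gamma> x\<close> for the single
  cell containing \<open>r x\<close>, and its distance to \<open>F x\<close> is at most the mesh times \<open>\<parallel>\<gamma> x\<parallel>\<close>.
\<close>

section \<open>Scalar inequalities and the norm on \<open>B_space\<close>\<close>

lemma scalar_ge_of_real [simp]: "scalar_ge (of_real r :: 'k::real_or_complex) b \<longleftrightarrow> b \<le> r"
  unfolding scalar_ge_def by auto

lemma B_norm_nonneg: "0 \<le> B_norm F"
  unfolding B_norm_def by (simp add: max.coboundedI2)

lemma B_norm_le:
  assumes "0 \<le> B" "\<And>x. norm (F x) \<le> B * norm x"
  shows "B_norm F \<le> ereal B"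
proof -
  have "norm (F x) / norm x \<le> B" if "x \<noteq> 0" for x
    using assms(2)[of x] that by (simp add: field_simps)
  moreover have "norm (F 0) \<le> B"
    using assms(1) assms(2)[of 0] by simp
  ultimately show ?thesis
    unfolding B_norm_def by (auto intro: SUP_least)
qed

text \<open>The hypothesis at the origin matters: a finite \<open>B_norm\<close> allows
  \<open>F 0\<close> to be nonzero, where no multiple of \<open>norm x\<close> bounds it.\<close>

lemma B_space_bound:
  assumes "F \<in> B_space" "F 0 = 0"
  obtains B where "0 \<le> B" "\<And>x. norm (F x) \<le> B * norm x"
proof -
  have "B_norm F < \<infinity>"
    using assms(1) by (simp add: B_space_def)
  then obtain B where B: "B_norm F = ereal B" "0 \<le> B"
    using B_norm_nonneg[of F] by (cases "B_norm F") auto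
  have "norm (F x) \<le> B * norm x" for x
  proof (cases "x = 0")
    case False
    then have "ereal (norm (F x) / norm x) \<le> B_norm F"
      unfolding B_norm_def by (intro max.coboundedI1 SUP_upper) simp
    then show ?thesis
      using False B by (simp add: field_simps)
  qed (use assms(2) in simp)
  with B(2) show thesis by (rule that)
qed

section \<open>Linearity and cancellation for the quasi-product\<close>

lemma quasi_product_diff_scaleR:
  assumes "unital_banach_algebra_over smul" "quasi_product smul q"
  shows "q (x - l *\<^sub>R y) z = q x z - of_real l * q y z"
proof -
  interpret unital_banach_algebra_over smul by fact
  obtain c where c: "\<And>n (\<alpha>::nat \<Rightarrow> 'a) (x::nat \<Rightarrow> 'b) y. n \<ge> 1 \<Longrightarrow>
      q (\<Sum>i=1..n. smul (\<alpha> i) (x i)) y = of_real (c y) * (\<Sum>i=1..n. \<alpha> i * q (x i) y)"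
    using assms(2) unfolding quasi_product_def by blast
  \<comment> \<open>The case \<open>n = 1\<close> of the axiom says that the factor \<open>c\<close> acts trivially.\<close>
  have c1: "of_real (c z) * q u z = q u z" for u
    using c[of 1 "\<lambda>_. 1" "\<lambda>_. u" z] by simp
  have "{1..2} = {1, 2::nat}" by auto
  \<comment> \<open>The coefficient is kept as \<open>of_real (- l)\<close> so that
    \<open>smul_of_real\<close> applies to it.\<close>
  then have "q (x - l *\<^sub>R y) z = of_real (c z) * (q x z + of_real (- l) * q y z)"
    using c[of 2 "\<lambda>i. if i = 1 then 1 else of_real (- l)" "\<lambda>i. if i = 1 then x else y" z]
    by (simp add: smul_of_real del: of_real_minus)
  also have "\<dots> = of_real (c z) * q x z - of_real l * (of_real (c z) * q y z)"
    by (simp add: algebra_simps)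
  finally show ?thesis by (simp add: c1)
qed

lemma spectral_condition_left_integral_domain:
  assumes "unital_banach_algebra_over smul" "quasi_product smul q"
    and "uniform_spectral_representation_condition q g"
  shows "left_integral_domain q g"
  using assms(3) unfolding uniform_spectral_representation_condition_def
proof (elim disjE conjE)
  assume sq: "square_bounded_below q g" and pos: "preserves_positivity q g"
  note q_diff = quasi_product_diff_scaleR[OF assms(1,2)]
  \<comment> \<open>Subtracting a vector from itself gives \<open>q 0 z = 0\<close>; subtracting
    \<open>y\<close> from \<open>0\<close> then gives the sign rule.\<close>
  have q_minus: "q (- y) z = - q y z" for y z
    using q_diff[of y 1 y z] q_diff[of 0 1 y z] q_diff[of 0 1 0 z] by simp
  show ?thesis
    unfolding left_integral_domain_def
  proof (intro allI impI)
    fix x y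
    assume g: "g x \<noteq> 0" and y: "q y (g x) = 0"
    \<comment> \<open>The value \<open>q y (g x) = 0\<close> is real, so the lower bound on squares
      covers this \<open>y\<close>.\<close>
    obtain k where k: "k > 0" "scalar_ge (q (y\<^sup>2) (g x)) (k * (norm y)\<^sup>2 * norm (g x))"
      using sq y unfolding square_bounded_below_def by force
    then obtain r where r: "q (y\<^sup>2) (g x) = of_real r" "k * (norm y)\<^sup>2 * norm (g x) \<le> r"
      unfolding scalar_ge_def by blast
    have ge0: "scalar_ge (0::'a) 0"
      using scalar_ge_of_real[of 0 0] by simp
    have "q (- y) (g x) = 0"
      by (simp add: q_minus y)
    then have "scalar_ge (q (y * - y) (g x)) 0"
      using pos y ge0 unfolding preserves_positivity_def by metis
    moreover have "q (y * - y) (g x) = of_real (- r)"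
      using r(1) by (simp add: q_minus power2_eq_square)
    ultimately have "r \<le> 0"
      by (simp del: of_real_minus)
    with r(2) have "k * norm (g x) * (norm y)\<^sup>2 \<le> 0"
      by (simp add: mult_ac)
    then show "y = 0"
      using k(1) g by (simp add: mult_le_0_iff)
  qed
qed

section \<open>Partitions, spectral sums and the jump of the spectral family\<close>

lemma partition_mono:
  fixes s :: "nat \<Rightarrow> real"
  assumes "\<And>j. j \<in> {1..n} \<Longrightarrow> s (j - 1) < s j" "i \<le> j" "j \<le> n"
  shows "s i \<le> s j"
  using assms(2,3)
proof (induction j rule: dec_induct)
  case (step k)
  then show ?case using assms(1)[of "Suc k"] by simp
qed simp

text \<open>As a function of \<open>l\<close>, \<open>E l x\<close> jumps from \<open>0\<close> to
  \<open>x\<close> at \<open>r\<close>, so its increment is \<open>x\<close> on the cell containing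
  \<open>r\<close> and \<open>0\<close> on the others, where \<open>\<gamma> 0 = 0\<close> removes
  the term. No linearity of \<open>\<gamma>\<close> enters.\<close>

lemma spectral_sum_single_cell:
  assumes s: "\<And>j. j \<in> {1..n} \<Longrightarrow> s (j - 1) < s j"
    and r: "s 0 < r" "r \<le> s n"
    and E: "\<And>l. E l x = (if r \<le> l then x else 0)"
    and "\<gamma> 0 = 0"
  obtains j where "j \<in> {1..n}" "s (j - 1) < r" "r \<le> s j"
    "spectral_sum \<gamma> E s t n x = t j *\<^sub>R \<gamma> x"
proof -
  define j where "j = (LEAST j. r \<le> s j)"
  have j: "r \<le> s j" "j \<le> n"
    unfolding j_def using r(2) by (auto intro: LeastI Least_le)
  have "j \<noteq> 0"
    using j(1) r(1) by (metis not_less)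
  then have j': "s (j - 1) < r"
    using not_less_Least[of "j - 1" "\<lambda>j. r \<le> s j"] by (simp add: j_def not_le)
  have "t i *\<^sub>R \<gamma> (E (s i) x - E (s (i - 1)) x) = (if i = j then t j *\<^sub>R \<gamma> x else 0)"
    if "i \<in> {1..n}" for i
  proof (cases i j rule: linorder_cases)
    case less
    then have "s i \<le> s (j - 1)" "s (i - 1) \<le> s (j - 1)"
      using j(2) by (auto intro!: partition_mono[of n] s)
    with j' less show ?thesis by (simp add: E assms(5))
  next
    case equal
    with j j' show ?thesis by (simp add: E)
  next
    case greater
    then have "s j \<le> s (i - 1)" "s j \<le> s i"
      using that by (auto intro!: partition_mono[of n] s)
    with j greater show ?thesis by (simp add: E assms(5))
  qed
  then have "spectral_sum \<gamma> E s t n x = (\<Sum>i=1..n. if i = j then t j *\<^sub>R \<gamma> x else 0)"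
    unfolding spectral_sum_def by (intro sum.cong) auto
  also have "\<dots> = t j *\<^sub>R \<gamma> x"
    using j \<open>j \<noteq> 0\<close> by simp
  finally show thesis
    using that[of j] j j' \<open>j \<noteq> 0\<close> by simp
qed

text \<open>The mesh bounds the error relative to \<open>norm (\<gamma> x)\<close> uniformly in
  \<open>x\<close>. Cells are open on the left, so the lower end must lie strictly below all
  \<open>r x\<close>; the shift by 1 ensures this and keeps the interval nondegenerate when
  \<open>R = 0\<close>.\<close>

lemma has_spectral_integral_multiplier:
  assumes R: "0 \<le> R" "\<And>x. \<bar>r x\<bar> \<le> R"
    and K: "0 \<le> K" "\<And>x. norm (\<gamma> x) \<le> K * norm x"
    and E: "\<And>l x. x \<noteq> 0 \<Longrightarrow> E l x = (if r x \<le> l then x else 0)" "\<And>l. E l 0 = 0"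
  shows "has_spectral_integral \<gamma> E (\<lambda>x. r x *\<^sub>R \<gamma> x) (- R - 1) R"
proof -
  let ?T = "\<lambda>x. r x *\<^sub>R \<gamma> x"
  have \<gamma>0: "\<gamma> 0 = 0"
    using K(2)[of 0] by simp
  have "norm (?T x) \<le> R * K * norm x" for x
    using mult_mono[OF R(2) K(2), of x x] R K by (simp add: mult_ac)
  then have "B_norm ?T \<le> ereal (R * K)"
    using R K by (intro B_norm_le) auto
  then have T: "?T \<in> B_space"
    by (auto simp: B_space_def intro: le_less_trans)
  have "(\<lambda>n. B_norm (\<lambda>x. spectral_sum \<gamma> E (s n) (t n) n x - ?T x)) \<longlonglongrightarrow> 0"
    if part: "tagged_partition_sequence (- R - 1) R s t" for s t
  proof -
    obtain \<epsilon> where \<epsilon>: "\<And>n. 0 < \<epsilon> n" "\<epsilon> \<longlonglongrightarrow> 0"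
      and ends: "\<And>n. n \<ge> 1 \<Longrightarrow> s n 0 = - R - 1 \<and> s n n = R"
      and cells: "\<And>n j. n \<ge> 1 \<Longrightarrow> j \<in> {1..n} \<Longrightarrow> s n (j - 1) < s n j \<and>
        s n j - s n (j - 1) < \<epsilon> n \<and> t n j \<in> {s n (j - 1)<..s n j}"
      using part unfolding tagged_partition_sequence_def by blast
    have bound: "norm (spectral_sum \<gamma> E (s n) (t n) n x - ?T x) \<le> \<epsilon> n * K * norm x"
      if n: "n \<ge> 1" for n x
    proof (cases "x = 0")
      case True
      then show ?thesis by (simp add: spectral_sum_def E \<gamma>0)
    next
      case False
      have r: "s n 0 < r x" "r x \<le> s n n"
        using R(2)[of x] ends[OF n] by auto
      obtain j where j: "j \<in> {1..n}" "s n (j - 1) < r x" "r x \<le> s n j"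
        and sum: "spectral_sum \<gamma> E (s n) (t n) n x = t n j *\<^sub>R \<gamma> x"
        by (rule spectral_sum_single_cell[of n "s n" "r x" E x \<gamma> "t n"])
          (use cells[OF n] r E(1)[OF False] \<gamma>0 in auto)
      \<comment> \<open>The tag and \<open>r x\<close> lie in the same cell.\<close>
      have "\<bar>t n j - r x\<bar> \<le> \<epsilon> n"
        using cells[OF n j(1)] j by auto
      then have "\<bar>t n j - r x\<bar> * norm (\<gamma> x) \<le> \<epsilon> n * (K * norm x)"
        using K \<epsilon>(1)[of n] by (intro mult_mono) auto
      then show ?thesis
        by (simp add: sum mult_ac flip: scaleR_left_diff_distrib)
    qed
    have "(\<lambda>n. \<epsilon> n * K) \<longlonglongrightarrow> 0"
      using tendsto_mult_left_zero[OF \<epsilon>(2)] .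
    then have "(\<lambda>n. ereal (\<epsilon> n * K)) \<longlonglongrightarrow> 0"
      by (simp add: zero_ereal_def)
    then show ?thesis
    proof (rule tendsto_sandwich[OF _ _ tendsto_const, rotated 2])
      show "\<forall>\<^sub>F n in sequentially. B_norm (\<lambda>x. spectral_sum \<gamma> E (s n) (t n) n x - ?T x)
          \<le> ereal (\<epsilon> n * K)"
        using eventually_ge_at_top[of 1]
        by eventually_elim
          (rule B_norm_le, use K \<epsilon>(1) bound in \<open>auto simp: less_imp_le\<close>)
    qed (simp add: B_norm_nonneg)
  qed
  then show ?thesis
    using R T unfolding has_spectral_integral_def by auto
qed

text \<open>The sign of \<open>r - l\<close> decides whether the positive part is
  \<open>(r - l) *\<^sub>R \<gamma> x\<close> or \<open>0\<close>. At \<open>l = r\<close> the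
  former vanishes too, hence the non-strict inequality.\<close>

lemma spectral_family_real_multiple:
  fixes q :: "'a::real_normed_vector \<Rightarrow> 'a \<Rightarrow> 'k::real_or_complex"
  assumes q_diff: "\<And>l. q (F x - l *\<^sub>R \<gamma> x) (g x) = q (F x) (g x) - of_real l * q (\<gamma> x) (g x)"
    and q\<gamma>: "q (\<gamma> x) (g x) = of_real b" "0 < b"
    and F: "F x = r *\<^sub>R \<gamma> x" and "\<gamma> x \<noteq> 0" "q (F x) (g x) = of_real r * q (\<gamma> x) (g x)"
  shows "spectral_family q g \<gamma> F l x = (if r \<le> l then x else 0)"
proof -
  have "q (F x - l *\<^sub>R \<gamma> x) (g x) = of_real ((r - l) * b)"
    by (simp add: q_diff q\<gamma>(1) assms(6) algebra_simps)
  then have "scalar_ge (q (F x - l *\<^sub>R \<gamma> x) (g x)) 0 \<longleftrightarrow> l \<le> r"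
    using q\<gamma>(2) by (simp add: zero_le_mult_iff del: of_real_mult of_real_diff)
  moreover have "F x - l *\<^sub>R \<gamma> x = (r - l) *\<^sub>R \<gamma> x"
    by (simp add: F algebra_simps)
  ultimately show ?thesis
    using assms(5)
    by (auto simp: spectral_family_def pos_part_map_def abs_map_def simp flip: scaleR_2)
qed

section \<open>The pointwise quotient of \<open>F\<close> by \<open>\<gamma>\<close> and its
  bound\<close>

theorem theorem3p23:
  fixes smul :: "'k::real_or_complex \<Rightarrow> 'a::{real_normed_algebra_1, banach} \<Rightarrow> 'a"
    and q :: "'a \<Rightarrow> 'a \<Rightarrow> 'k"
    and g \<gamma> F :: "'a \<Rightarrow> 'a"
    and k1 k2 :: "'a \<Rightarrow> real"
  assumes "unital_banach_algebra_over smul"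
    and "quasi_product smul q"
    and "\<And>x. x \<noteq> 0 \<Longrightarrow> g x \<noteq> 0"
    and "g_positive q g \<gamma>"
    and "positive_bounded_away k1" and "positive_bounded_away k2"
    and "\<And>x. q (\<gamma> x) (g x) = of_real (k1 x * norm x * norm (g x))"
    and "\<And>x. norm (\<gamma> x) = k2 x * norm x"
    and "F \<in> B_space"
    and "generalized_real_definite q g F"
    and "F 0 = 0"
    and "uniform_spectral_representation_condition q g"
  shows "\<exists>m M. has_spectral_integral \<gamma> (spectral_family q g \<gamma> F) F m M"
proof -
  note q_diff = quasi_product_diff_scaleR[OF assms(1,2)]
  have lid: "\<And>x y. g x \<noteq> 0 \<Longrightarrow> q y (g x) = 0 \<Longrightarrow> y = 0"
    using spectral_condition_left_integral_domain[OF assms(1,2,12)]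
    unfolding left_integral_domain_def by blast
  obtain C where C: "C > 0" "\<And>x y. norm (q x y) \<le> C * norm x * norm y"
    using assms(2) unfolding quasi_product_def by blast
  obtain B where B: "0 \<le> B" "\<And>x. norm (F x) \<le> B * norm x"
    using B_space_bound[OF assms(9,11)] by blast
  obtain a where a: "0 < a" "\<And>x. a \<le> k1 x"
    using assms(5) unfolding positive_bounded_away_def by blast
  obtain a' K where K: "0 < a'" "\<And>x. a' \<le> k2 x" "\<And>x. k2 x \<le> K"
    using assms(6) unfolding positive_bounded_away_def by blast
  have "0 \<le> K"
    using K(1) K(2)[of 0] K(3)[of 0] by linarith
  define b where "b x = k1 x * norm x * norm (g x)" for x
  have b: "q (\<gamma> x) (g x) = of_real (b x)" for x
    by (simp add: b_def assms(7))
  have b_pos: "0 < b x" if "x \<noteq> 0" for x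
    using that assms(3)[OF that] a(1) a(2)[of x] by (simp add: b_def)
  have "\<forall>x. \<exists>a. q (F x) (g x) = of_real a"
    using assms(10) unfolding generalized_real_definite_def by (blast elim: Reals_cases)
  then obtain f where f: "\<And>x. q (F x) (g x) = of_real (f x)"
    using choice[of "\<lambda>x a. q (F x) (g x) = of_real a"] by blast
  \<comment> \<open>Division by \<open>b 0 = 0\<close> makes \<open>r 0 = 0\<close>.\<close>
  define r where "r x = f x / b x" for x
  have F_eq: "F x = r x *\<^sub>R \<gamma> x" for x
  proof (cases "x = 0")
    case True
    then show ?thesis by (simp add: assms(11) r_def b_def)
  next
    case False
    then have "q (F x - r x *\<^sub>R \<gamma> x) (g x) = 0"
      using b_pos[OF False] by (simp add: q_diff f b r_def)
    then have "F x - r x *\<^sub>R \<gamma> x = 0"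
      by (rule lid[OF assms(3)[OF False]])
    then show ?thesis by simp
  qed
  \<comment> \<open>\<open>C\<close> bounds the quasi-product and \<open>B\<close> bounds
    \<open>F\<close>, while \<open>a\<close> bounds \<open>k1\<close> from below in the denominator
    \<open>b x\<close>.\<close>
  have r_bound: "\<bar>r x\<bar> \<le> C * B / a" for x
  proof (cases "x = 0")
    case True
    then show ?thesis using a B C by (simp add: r_def b_def)
  next
    case False
    have "\<bar>f x\<bar> \<le> C * norm (F x) * norm (g x)"
      using C(2)[of "F x" "g x"] by (simp add: f)
    also have "\<dots> \<le> C * (B * norm x) * norm (g x)"
      using C(1) B(2)[of x] by (intro mult_right_mono mult_left_mono) auto
    also have "\<dots> = C * B / a * (a * norm x * norm (g x))"
      using a(1) by simp
    also have "\<dots> \<le> C * B / a * b x"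
      unfolding b_def using a B(1) C(1) by (intro mult_left_mono mult_right_mono) auto
    finally show ?thesis
      using b_pos[OF False] by (simp add: r_def pos_divide_le_eq)
  qed
  have E: "spectral_family q g \<gamma> F l x = (if r x \<le> l then x else 0)" if "x \<noteq> 0" for l x
  proof (rule spectral_family_real_multiple[where b = "b x"])
    have "norm (\<gamma> x) > 0"
      using K(1) K(2)[of x] that by (simp add: assms(8))
    then show "\<gamma> x \<noteq> 0" by simp
    show "q (F x) (g x) = of_real (r x) * q (\<gamma> x) (g x)"
      using b_pos[OF that] by (simp add: f b r_def)
  qed (fact q_diff b b_pos[OF that] F_eq)+
  have "has_spectral_integral \<gamma> (spectral_family q g \<gamma> F) (\<lambda>x. r x *\<^sub>R \<gamma> x)
      (- (C * B / a) - 1) (C * B / a)"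
  proof (rule has_spectral_integral_multiplier[OF _ r_bound \<open>0 \<le> K\<close> _ E])
    show "norm (\<gamma> x) \<le> K * norm x" for x
      using K(3)[of x] by (simp add: assms(8) mult_right_mono)
    show "spectral_family q g \<gamma> F l 0 = 0" for l
      by (simp add: spectral_family_def)
  qed (use a B C in auto)
  moreover have "(\<lambda>x. r x *\<^sub>R \<gamma> x) = F"
    using F_eq by auto
  ultimately show ?thesis by auto
qed

end
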